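(* Every cut-free and $\ell$-$r$-variant-free proof in the focused display calculus fD.LG is strongly focalized. That is: let $\pi$ be an fD.LG-proof in which no cut rule is used and in whose sequents none of the structural $\ell$- or $r$-variants occurs; then for every formula $A$ occurring in a sequent of $\pi$ (with the sign it inherits from its position in that sequent), every PIA subtree of the signed generation tree of $A$ is constructed by a proof-section of $\pi$ containing only (applications of) tonicity rules.
   Context: **The calculus fD.LG.** Fix two disjoint countably infinite sets of positive atoms $p$ and negative atoms $n$. Formulas of four sorts: pure positive $P ::= p\mid \mathring P\otimes\mathring P\mid \mathring P\oslash\mathring N\mid \mathring N\ominus\mathring P$; pure negative $N ::= n\mid \mathring N\oplus\mathring N\mid \mathring P\backslash\mathring N\mid \mathring N/\mathring P$; shifted positive $\dot P ::= \,\downarrow N$; shifted negative $\dot N ::= \,\uparrow P$. A ring means "pure or shifted": $\mathring P$ (general positive) is $P$ or $\dot P$, $\mathring N$ (general negative) is $N$ or $\dot N$; same convention for structures and for $Q,M,\dots$ Structures (structural connectives carry $\hat{\ }$ or $\check{\ }$): pure positive $X ::= P\mid \check{\Downarrow}\dot\Delta\mid \mathring X\hat\otimes\mathring X\mid\mathring X\hat\oslash\mathring\Delta\mid\mathring\Delta\hat\ominus\mathring X$; pure negative $\Delta ::= N\mid\hat{\Uparrow}\dot X\mid\mathring\Delta\check\oplus\mathring\Delta\mid\mathring X\check\backslash\mathring\Delta\mid\mathring\Delta\check/\mathring X$; shifted positive $\dot X ::= \dot P\mid\check\downarrow\Delta\mid\mathring X\check\oplus_\ell\mathring\Delta\mid\mathring\Delta\check\oplus_r\mathring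 X\mid\mathring\Delta\check\backslash_\ell\mathring\Delta\mid\mathring X\check\backslash_r\mathring X\mid\mathring X\check/_\ell\mathring X\mid\mathring\Delta\check/_r\mathring\Delta$; shifted negative $\dot\Delta ::= \dot N\mid\hat\uparrow X\mid\mathring\Delta\hat\otimes_\ell\mathring X\mid\mathring X\hat\otimes_r\mathring\Delta\mid\mathring\Delta\hat\oslash_\ell\mathring\Delta\mid\mathring X\hat\oslash_r\mathring X\mid\mathring X\hat\ominus_\ell\mathring X\mid\mathring\Delta\hat\ominus_r\mathring\Delta$. The connectives with subscript $\ell$ or $r$ are the $\ell$-$r$-variants; they and $\Uparrow,\Downarrow$ exist only structurally. All other connectives have both a structural and an operational (logical) form. Sequents: positive $\mathring X\vdash_+\mathring Y$, negative $\mathring\Gamma\vdash_-\mathring\Delta$, neutral $\mathring X\vdash_0\mathring\Delta$ (the exact turnstile is determined by the sorts of both sides). Rules ($\Rightarrow$: premises to conclusion; $\Leftrightarrow$: both directions). *Axioms:* $p\vdash_+p$; $n\vdash_-n$. *Cuts:* $\mathring X\vdash_+\mathring P,\ \mathring P\vdash_+\mathring Y\Rightarrow\mathring X\vdash_+\mathring Y$; $\mathring\Gamma\vdash_-\mathring N,\ \mathring N\vdash_-\mathring\Delta\Rightarrow\mathring\Gamma\vdash_-\mathring\Delta$; $\mathring X\vdash_+\mathring P,\ \mathring P\vdash_0\mathring\Delta\Rightarrow\mathring X\vdash_0\mathring\Delta$; $\mathring X\vdash_0\mathring N,\ \mathring N\vdash_-\mathring\Delta\Rightarrow\mathring X\vdash_0\mathring\Delta$.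 *Translation rules:* $\mathring P\hat\otimes\mathring Q\vdash_0\mathring\Delta\Rightarrow\mathring P\otimes\mathring Q\vdash_0\mathring\Delta$; $\mathring P\hat\oslash\mathring N\vdash_0\mathring\Delta\Rightarrow\mathring P\oslash\mathring N\vdash_0\mathring\Delta$; $\mathring N\hat\ominus\mathring P\vdash_0\mathring\Delta\Rightarrow\mathring N\ominus\mathring P\vdash_0\mathring\Delta$; $\mathring X\vdash_0\mathring N\check\oplus\mathring M\Rightarrow\mathring X\vdash_0\mathring N\oplus\mathring M$; $\mathring X\vdash_0\mathring P\check\backslash\mathring N\Rightarrow\mathring X\vdash_0\mathring P\backslash\mathring N$; $\mathring X\vdash_0\mathring N\check/\mathring P\Rightarrow\mathring X\vdash_0\mathring N/\mathring P$; $\mathring X\vdash_+\check\downarrow N\Rightarrow\mathring X\vdash_+\downarrow N$; $\hat\uparrow P\vdash_-\mathring\Delta\Rightarrow\ \uparrow P\vdash_-\mathring\Delta$. *Tonicity rules:* $\mathring X\vdash_+\mathring P,\ \mathring Y\vdash_+\mathring Q\Rightarrow\mathring X\hat\otimes\mathring Y\vdash_+\mathring P\otimes\mathring Q$; $\mathring N\vdash_-\mathring\Gamma,\ \mathring M\vdash_-\mathring\Delta\Rightarrow\mathring N\oplus\mathring M\vdash_-\mathring\Gamma\check\oplus\mathring\Delta$; from $\mathring X\vdash_+\mathring P$ and $\mathring N\vdash_-\mathring\Delta$ infer each of $\mathring X\hat\oslash\mathring\Delta\vdash_+\mathring P\oslash\mathring N$, $\ \mathring\Delta\hat\ominus\mathring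 X\vdash_+\mathring N\ominus\mathring P$, $\ \mathring P\backslash\mathring N\vdash_-\mathring X\check\backslash\mathring\Delta$, $\ \mathring N/\mathring P\vdash_-\mathring\Delta\check/\mathring X$; $N\vdash_-\Delta\Rightarrow\ \downarrow N\vdash_+\check\downarrow\Delta$; $X\vdash_+P\Rightarrow\hat\uparrow X\vdash_-\uparrow P$. *Display postulates:* $\mathring Y\vdash_0\mathring X\check\backslash\mathring\Delta\Leftrightarrow\mathring X\hat\otimes\mathring Y\vdash_0\mathring\Delta\Leftrightarrow\mathring X\vdash_0\mathring\Delta\check/\mathring Y$; $\mathring X\hat\oslash\mathring\Delta\vdash_0\mathring\Gamma\Leftrightarrow\mathring X\vdash_0\mathring\Gamma\check\oplus\mathring\Delta\Leftrightarrow\mathring\Gamma\hat\ominus\mathring X\vdash_0\mathring\Delta$; $\mathring Y\vdash_+\mathring X\check\backslash_r\mathring Z\Leftrightarrow\mathring X\hat\otimes\mathring Y\vdash_+\mathring Z\Leftrightarrow\mathring X\vdash_+\mathring Z\check/_\ell\mathring Y$; $\mathring\Sigma\hat\oslash_\ell\mathring\Delta\vdash_-\mathring\Gamma\Leftrightarrow\mathring\Sigma\vdash_-\mathring\Gamma\check\oplus\mathring\Delta\Leftrightarrow\mathring\Gamma\hat\ominus_r\mathring\Sigma\vdash_-\mathring\Delta$; $\mathring\Gamma\hat\ominus\mathring X\vdash_+\mathring Y\Leftrightarrow\mathring X\vdash_+\mathring\Gamma\check\oplus_r\mathring Y\Leftrightarrow\mathring X\hat\oslash_r\mathring Y\vdash_-\mathring\Gamma$;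 $\mathring X\hat\oslash\mathring\Delta\vdash_+\mathring Y\Leftrightarrow\mathring X\vdash_+\mathring Y\check\oplus_\ell\mathring\Delta\Leftrightarrow\mathring Y\hat\ominus_\ell\mathring X\vdash_-\mathring\Delta$; $\mathring\Gamma\vdash_-\mathring X\check\backslash\mathring\Delta\Leftrightarrow\mathring X\hat\otimes_r\mathring\Gamma\vdash_-\mathring\Delta\Leftrightarrow\mathring X\vdash_+\mathring\Delta\check/_r\mathring\Gamma$; $\mathring Y\vdash_+\mathring\Gamma\check\backslash_\ell\mathring\Delta\Leftrightarrow\mathring\Gamma\hat\otimes_\ell\mathring Y\vdash_-\mathring\Delta\Leftrightarrow\mathring\Gamma\vdash_-\mathring\Delta\check/\mathring Y$; $\hat\uparrow X\vdash_-\dot\Delta\Leftrightarrow X\vdash_+\check\Downarrow\dot\Delta$; $\hat\uparrow X\vdash_-\Delta\Leftrightarrow X\vdash_+\check\downarrow\Delta$; $\dot X\vdash_+\check\downarrow\Delta\Leftrightarrow\hat\Uparrow\dot X\vdash_-\Delta$. *Structural rules:* $\mathring X\vdash_0\Delta\Leftrightarrow\mathring X\vdash_+\check\downarrow\Delta$; $X\vdash_0\mathring\Delta\Leftrightarrow\hat\uparrow X\vdash_-\mathring\Delta$. **Signed generation trees.** $\mathcal F$-connectives: $\otimes,\oslash,\ominus$ with their variants, $\uparrow,\Uparrow$. $\mathcal G$-connectives: $\oplus,\backslash,/$ with their variants, $\downarrow,\Downarrow$. Order-types (same for variants): $\otimes,\oplus$: $(1,1)$; $\ominus,\backslash$: $(\partial,1)$;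 $\oslash,/$: $(1,\partial)$; shifts: $(1)$. The signed generation tree $+\Psi$ (resp. $-\Psi$) labels the root of the syntax tree with $+$ (resp. $-$) and passes the same sign to the $i$-th child if the order-type at $i$ is $1$, the opposite sign if it is $\partial$. A sequent with sides $\Psi$ (left) and $\Phi$ (right) has signed trees $+\Psi$ and $-\Phi$. A node is *skeleton* if labelled $+f$ with $f\in\mathcal F$ or $-g$ with $g\in\mathcal G$; otherwise it is *PIA* (in the paper's example positive atoms are treated like $\mathcal F$ and negative atoms like $\mathcal G$). A signed tree is partitioned into (maximal connected) skeleton subtrees and PIA subtrees. **Proof-section.** A proof-section $\pi'$ of a proof-tree $\pi$ is a connected subgraph of $\pi$ such that for every node (sequent) $S\in\pi'$, if $S$ is not a leaf of $\pi'$ and is introduced by a rule application $R$, then the premises of $R$ are also in $\pi'$. A PIA subtree is constructed by a proof-section if all its connectives are introduced by the rules applied in that section. **Strong focalization.** A sequent proof $\pi$ is strongly focalized if it is cut-free and, for every formula $A$ occurring in $\pi$, every PIA subtree of $A$ is constructed by a proof-section of $\pi$ containing only tonicity rules. *)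

theory Defs
  imports Main
begin

section \<open>Ordered trees and addresses\<close>

datatype 'a tree = Node (root_of: 'a) (children: "'a tree list")

fun subtree :: "'a tree \<Rightarrow> nat list \<Rightarrow> 'a tree option" where
  "subtree t [] = Some t"
| "subtree (Node a ts) (i # p) = (if i < length ts then subtree (ts ! i) p else None)"

definition positions :: "'a tree \<Rightarrow> nat list set" where
  "positions t = {p. subtree t p \<noteq> None}"

definition label_at :: "'a tree \<Rightarrow> nat list \<Rightarrow> 'a option" where
  "label_at t p = map_option root_of (subtree t p)"

text \<open>Connectedness of the subgraph induced by a set of addresses; the edges are the
  parent-child pairs.\<close>

definition connected_in_tree :: "nat list set \<Rightarrow> bool" where
  "connected_in_tree D \<longleftrightarrow>
     (\<forall>a\<in>D. \<forall>b\<in>D.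
        (a, b) \<in> {(x, y). x \<in> D \<and> y \<in> D \<and> (\<exists>i. y = x @ [i] \<or> x = y @ [i])}\<^sup>*)"


section \<open>Formulas and structures\<close>

datatype connective =
    Otimes | Oslash | Ominus | Oplus | Under | Over | Down | Up
  | DDown | UUp
  | Otimes_l | Otimes_r | Oslash_l | Oslash_r | Ominus_l | Ominus_r
  | Oplus_l | Oplus_r | Under_l | Under_r | Over_l | Over_r

definition lr_variants :: "connective set" where
  "lr_variants =
     {Otimes_l, Otimes_r, Oslash_l, Oslash_r, Ominus_l, Ominus_r,
      Oplus_l, Oplus_r, Under_l, Under_r, Over_l, Over_r}"

definition operational :: "connective set" where
  "operational = - (lr_variants \<union> {DDown, UUp})"

text \<open>The general sorts are the ringed ones, pure or shifted.\<close>

datatype sort = PureP | PureN | ShiftedP | ShiftedN | GenP | GenN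

text \<open>The production of the grammar for each connective, which is the same for
  its operational and its structural form.\<close>

fun arg_sorts :: "connective \<Rightarrow> sort list" where
  "arg_sorts Otimes = [GenP, GenP]"
| "arg_sorts Oslash = [GenP, GenN]"
| "arg_sorts Ominus = [GenN, GenP]"
| "arg_sorts Oplus = [GenN, GenN]"
| "arg_sorts Under = [GenP, GenN]"
| "arg_sorts Over = [GenN, GenP]"
| "arg_sorts Down = [PureN]"
| "arg_sorts Up = [PureP]"
| "arg_sorts DDown = [ShiftedN]"
| "arg_sorts UUp = [ShiftedP]"
| "arg_sorts Oplus_l = [GenP, GenN]"
| "arg_sorts Oplus_r = [GenN, GenP]"
| "arg_sorts Under_l = [GenN, GenN]"
| "arg_sorts Under_r = [GenP, GenP]"
| "arg_sorts Over_l = [GenP, GenP]"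
| "arg_sorts Over_r = [GenN, GenN]"
| "arg_sorts Otimes_l = [GenN, GenP]"
| "arg_sorts Otimes_r = [GenP, GenN]"
| "arg_sorts Oslash_l = [GenN, GenN]"
| "arg_sorts Oslash_r = [GenP, GenP]"
| "arg_sorts Ominus_l = [GenP, GenP]"
| "arg_sorts Ominus_r = [GenN, GenN]"

fun result_sort :: "connective \<Rightarrow> sort" where
  "result_sort Otimes = PureP"
| "result_sort Oslash = PureP"
| "result_sort Ominus = PureP"
| "result_sort DDown = PureP"
| "result_sort Oplus = PureN"
| "result_sort Under = PureN"
| "result_sort Over = PureN"
| "result_sort UUp = PureN"
| "result_sort Down = ShiftedP"
| "result_sort Oplus_l = ShiftedP"
| "result_sort Oplus_r = ShiftedP"
| "result_sort Under_l = ShiftedP"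
| "result_sort Under_r = ShiftedP"
| "result_sort Over_l = ShiftedP"
| "result_sort Over_r = ShiftedP"
| "result_sort Up = ShiftedN"
| "result_sort Otimes_l = ShiftedN"
| "result_sort Otimes_r = ShiftedN"
| "result_sort Oslash_l = ShiftedN"
| "result_sort Oslash_r = ShiftedN"
| "result_sort Ominus_l = ShiftedN"
| "result_sort Ominus_r = ShiftedN"

datatype symbol =
    PAtom nat
  | NAtom nat
  | Op connective  \<comment> \<open>operational (logical) form\<close>
  | St connective  \<comment> \<open>structural form\<close>

type_synonym expr = "symbol tree"

inductive formula :: "expr \<Rightarrow> sort \<Rightarrow> bool" where
  formula_PAtom: "formula (Node (PAtom k) []) PureP"
| formula_NAtom: "formula (Node (NAtom k) []) PureN"
| formula_Op: "c \<in> operational \<Longrightarrow> list_all2 formula ts (arg_sorts c) \<Longrightarrow>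
    formula (Node (Op c) ts) (result_sort c)"
| formula_PureP: "formula t PureP \<Longrightarrow> formula t GenP"
| formula_ShiftedP: "formula t ShiftedP \<Longrightarrow> formula t GenP"
| formula_PureN: "formula t PureN \<Longrightarrow> formula t GenN"
| formula_ShiftedN: "formula t ShiftedN \<Longrightarrow> formula t GenN"

inductive struct :: "expr \<Rightarrow> sort \<Rightarrow> bool" where
  struct_formula: "formula t s \<Longrightarrow> struct t s"
| struct_St: "list_all2 struct ts (arg_sorts c) \<Longrightarrow> struct (Node (St c) ts) (result_sort c)"
| struct_PureP: "struct t PureP \<Longrightarrow> struct t GenP"
| struct_ShiftedP: "struct t ShiftedP \<Longrightarrow> struct t GenP"
| struct_PureN: "struct t PureN \<Longrightarrow> struct t GenN"
| struct_ShiftedN: "struct t ShiftedN \<Longrightarrow> struct t GenN"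


section \<open>Sequents and rules\<close>

datatype turnstile = Positive | Negative | Neutral

datatype 'a sequent = Sequent turnstile "'a tree" "'a tree"

datatype side = Ante | Succ

fun side_of :: "'a sequent \<Rightarrow> side \<Rightarrow> 'a tree" where
  "side_of (Sequent e l r) Ante = l"
| "side_of (Sequent e l r) Succ = r"

text \<open>Rules are given by schemas: expressions with metavariable leaves for formulas
  and for structures of a given sort. The positions of the metavariables determine how
  occurrences in the conclusion of an application correspond to occurrences in its
  premises.\<close>

datatype metavar = FVar sort nat | SVar sort nat

datatype schematic = Con symbol | Meta metavar

type_synonym schema = "schematic tree"

fun inst :: "(metavar \<Rightarrow> expr) \<Rightarrow> schema \<Rightarrow> expr" where
  "inst \<sigma> (Node (Con a) ts) = Node a (map (inst \<sigma>) ts)"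
| "inst \<sigma> (Node (Meta v) ts) = \<sigma> v"

fun inst_sequent :: "(metavar \<Rightarrow> expr) \<Rightarrow> schematic sequent \<Rightarrow> symbol sequent" where
  "inst_sequent \<sigma> (Sequent e l r) = Sequent e (inst \<sigma> l) (inst \<sigma> r)"

definition well_sorted :: "(metavar \<Rightarrow> expr) \<Rightarrow> bool" where
  "well_sorted \<sigma> \<longleftrightarrow>
     (\<forall>s i. formula (\<sigma> (FVar s i)) s) \<and> (\<forall>s i. struct (\<sigma> (SVar s i)) s)"

datatype rule_class = Axiom | Cut | Translation | Tonicity | Display | Structural

datatype rule = Rule rule_class "schematic sequent list" "schematic sequent"

fun class_of :: "rule \<Rightarrow> rule_class" where
  "class_of (Rule k ps c) = k"

fun both_ways :: "rule_class \<Rightarrow> schematic sequent \<Rightarrow> schematic sequent \<Rightarrow> rule list" where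
  "both_ways k S T = [Rule k [S] T, Rule k [T] S]"

abbreviation posseq :: "schema \<Rightarrow> schema \<Rightarrow> schematic sequent" (infix "\<turnstile>\<^sub>+" 50) where
  "l \<turnstile>\<^sub>+ r \<equiv> Sequent Positive l r"
abbreviation negseq :: "schema \<Rightarrow> schema \<Rightarrow> schematic sequent" (infix "\<turnstile>\<^sub>-" 50) where
  "l \<turnstile>\<^sub>- r \<equiv> Sequent Negative l r"
abbreviation neutseq :: "schema \<Rightarrow> schema \<Rightarrow> schematic sequent" (infix "\<turnstile>\<^sub>0" 50) where
  "l \<turnstile>\<^sub>0 r \<equiv> Sequent Neutral l r"

abbreviation op_sch :: "connective \<Rightarrow> schema list \<Rightarrow> schema" where
  "op_sch c ts \<equiv> Node (Con (Op c)) ts"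
abbreviation st_sch :: "connective \<Rightarrow> schema list \<Rightarrow> schema" where
  "st_sch c ts \<equiv> Node (Con (St c)) ts"
abbreviation fvar :: "sort \<Rightarrow> nat \<Rightarrow> schema" where
  "fvar s i \<equiv> Node (Meta (FVar s i)) []"
abbreviation svar :: "sort \<Rightarrow> nat \<Rightarrow> schema" where
  "svar s i \<equiv> Node (Meta (SVar s i)) []"

text \<open>Metavariables; the subscripts stand for general (ringed), pure and shifted (dotted).\<close>

abbreviation "P\<^sub>g \<equiv> fvar GenP 0"
abbreviation "Q\<^sub>g \<equiv> fvar GenP 1"
abbreviation "N\<^sub>g \<equiv> fvar GenN 0"
abbreviation "M\<^sub>g \<equiv> fvar GenN 1"
abbreviation "P\<^sub>p \<equiv> fvar PureP 0"
abbreviation "N\<^sub>p \<equiv> fvar PureN 0"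
abbreviation "X\<^sub>g \<equiv> svar GenP 0"
abbreviation "Y\<^sub>g \<equiv> svar GenP 1"
abbreviation "Z\<^sub>g \<equiv> svar GenP 2"
abbreviation "\<Gamma>\<^sub>g \<equiv> svar GenN 0"
abbreviation "\<Delta>\<^sub>g \<equiv> svar GenN 1"
abbreviation "\<Sigma>\<^sub>g \<equiv> svar GenN 2"
abbreviation "X\<^sub>p \<equiv> svar PureP 0"
abbreviation "\<Delta>\<^sub>p \<equiv> svar PureN 0"
abbreviation "X\<^sub>s \<equiv> svar ShiftedP 0"
abbreviation "\<Delta>\<^sub>s \<equiv> svar ShiftedN 0"

definition axioms :: "rule set" where
  "axioms =
     {Rule Axiom [] (Node (Con (PAtom k)) [] \<turnstile>\<^sub>+ Node (Con (PAtom k)) []) | k. True} \<union>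
     {Rule Axiom [] (Node (Con (NAtom k)) [] \<turnstile>\<^sub>- Node (Con (NAtom k)) []) | k. True}"

definition cut_rules :: "rule list" where
  "cut_rules =
    [Rule Cut [X\<^sub>g \<turnstile>\<^sub>+ P\<^sub>g, P\<^sub>g \<turnstile>\<^sub>+ Y\<^sub>g] (X\<^sub>g \<turnstile>\<^sub>+ Y\<^sub>g),
     Rule Cut [\<Gamma>\<^sub>g \<turnstile>\<^sub>- N\<^sub>g, N\<^sub>g \<turnstile>\<^sub>- \<Delta>\<^sub>g] (\<Gamma>\<^sub>g \<turnstile>\<^sub>- \<Delta>\<^sub>g),
     Rule Cut [X\<^sub>g \<turnstile>\<^sub>+ P\<^sub>g, P\<^sub>g \<turnstile>\<^sub>0 \<Delta>\<^sub>g] (X\<^sub>g \<turnstile>\<^sub>0 \<Delta>\<^sub>g),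
     Rule Cut [X\<^sub>g \<turnstile>\<^sub>0 N\<^sub>g, N\<^sub>g \<turnstile>\<^sub>- \<Delta>\<^sub>g] (X\<^sub>g \<turnstile>\<^sub>0 \<Delta>\<^sub>g)]"

definition translation_rules :: "rule list" where
  "translation_rules =
    [Rule Translation [st_sch Otimes [P\<^sub>g, Q\<^sub>g] \<turnstile>\<^sub>0 \<Delta>\<^sub>g] (op_sch Otimes [P\<^sub>g, Q\<^sub>g] \<turnstile>\<^sub>0 \<Delta>\<^sub>g),
     Rule Translation [st_sch Oslash [P\<^sub>g, N\<^sub>g] \<turnstile>\<^sub>0 \<Delta>\<^sub>g] (op_sch Oslash [P\<^sub>g, N\<^sub>g] \<turnstile>\<^sub>0 \<Delta>\<^sub>g),
     Rule Translation [st_sch Ominus [N\<^sub>g, P\<^sub>g] \<turnstile>\<^sub>0 \<Delta>\<^sub>g] (op_sch Ominus [N\<^sub>g, P\<^sub>g] \<turnstile>\<^sub>0 \<Delta>\<^sub>g),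
     Rule Translation [X\<^sub>g \<turnstile>\<^sub>0 st_sch Oplus [N\<^sub>g, M\<^sub>g]] (X\<^sub>g \<turnstile>\<^sub>0 op_sch Oplus [N\<^sub>g, M\<^sub>g]),
     Rule Translation [X\<^sub>g \<turnstile>\<^sub>0 st_sch Under [P\<^sub>g, N\<^sub>g]] (X\<^sub>g \<turnstile>\<^sub>0 op_sch Under [P\<^sub>g, N\<^sub>g]),
     Rule Translation [X\<^sub>g \<turnstile>\<^sub>0 st_sch Over [N\<^sub>g, P\<^sub>g]] (X\<^sub>g \<turnstile>\<^sub>0 op_sch Over [N\<^sub>g, P\<^sub>g]),
     Rule Translation [X\<^sub>g \<turnstile>\<^sub>+ st_sch Down [N\<^sub>p]] (X\<^sub>g \<turnstile>\<^sub>+ op_sch Down [N\<^sub>p]),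
     Rule Translation [st_sch Up [P\<^sub>p] \<turnstile>\<^sub>- \<Delta>\<^sub>g] (op_sch Up [P\<^sub>p] \<turnstile>\<^sub>- \<Delta>\<^sub>g)]"

definition tonicity_rules :: "rule list" where
  "tonicity_rules =
    [Rule Tonicity [X\<^sub>g \<turnstile>\<^sub>+ P\<^sub>g, Y\<^sub>g \<turnstile>\<^sub>+ Q\<^sub>g]
       (st_sch Otimes [X\<^sub>g, Y\<^sub>g] \<turnstile>\<^sub>+ op_sch Otimes [P\<^sub>g, Q\<^sub>g]),
     Rule Tonicity [N\<^sub>g \<turnstile>\<^sub>- \<Gamma>\<^sub>g, M\<^sub>g \<turnstile>\<^sub>- \<Delta>\<^sub>g]
       (op_sch Oplus [N\<^sub>g, M\<^sub>g] \<turnstile>\<^sub>- st_sch Oplus [\<Gamma>\<^sub>g, \<Delta>\<^sub>g]),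
     Rule Tonicity [X\<^sub>g \<turnstile>\<^sub>+ P\<^sub>g, N\<^sub>g \<turnstile>\<^sub>- \<Delta>\<^sub>g]
       (st_sch Oslash [X\<^sub>g, \<Delta>\<^sub>g] \<turnstile>\<^sub>+ op_sch Oslash [P\<^sub>g, N\<^sub>g]),
     Rule Tonicity [X\<^sub>g \<turnstile>\<^sub>+ P\<^sub>g, N\<^sub>g \<turnstile>\<^sub>- \<Delta>\<^sub>g]
       (st_sch Ominus [\<Delta>\<^sub>g, X\<^sub>g] \<turnstile>\<^sub>+ op_sch Ominus [N\<^sub>g, P\<^sub>g]),
     Rule Tonicity [X\<^sub>g \<turnstile>\<^sub>+ P\<^sub>g, N\<^sub>g \<turnstile>\<^sub>- \<Delta>\<^sub>g]
       (op_sch Under [P\<^sub>g, N\<^sub>g] \<turnstile>\<^sub>- st_sch Under [X\<^sub>g, \<Delta>\<^sub>g]),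
     Rule Tonicity [X\<^sub>g \<turnstile>\<^sub>+ P\<^sub>g, N\<^sub>g \<turnstile>\<^sub>- \<Delta>\<^sub>g]
       (op_sch Over [N\<^sub>g, P\<^sub>g] \<turnstile>\<^sub>- st_sch Over [\<Delta>\<^sub>g, X\<^sub>g]),
     Rule Tonicity [N\<^sub>p \<turnstile>\<^sub>- \<Delta>\<^sub>p] (op_sch Down [N\<^sub>p] \<turnstile>\<^sub>+ st_sch Down [\<Delta>\<^sub>p]),
     Rule Tonicity [X\<^sub>p \<turnstile>\<^sub>+ P\<^sub>p] (st_sch Up [X\<^sub>p] \<turnstile>\<^sub>- op_sch Up [P\<^sub>p])]"

definition display_rules :: "rule list" where
  "display_rules = concat
    [both_ways Display (Y\<^sub>g \<turnstile>\<^sub>0 st_sch Under [X\<^sub>g, \<Delta>\<^sub>g]) (st_sch Otimes [X\<^sub>g, Y\<^sub>g] \<turnstile>\<^sub>0 \<Delta>\<^sub>g),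
     both_ways Display (st_sch Otimes [X\<^sub>g, Y\<^sub>g] \<turnstile>\<^sub>0 \<Delta>\<^sub>g) (X\<^sub>g \<turnstile>\<^sub>0 st_sch Over [\<Delta>\<^sub>g, Y\<^sub>g]),
     both_ways Display (st_sch Oslash [X\<^sub>g, \<Delta>\<^sub>g] \<turnstile>\<^sub>0 \<Gamma>\<^sub>g) (X\<^sub>g \<turnstile>\<^sub>0 st_sch Oplus [\<Gamma>\<^sub>g, \<Delta>\<^sub>g]),
     both_ways Display (X\<^sub>g \<turnstile>\<^sub>0 st_sch Oplus [\<Gamma>\<^sub>g, \<Delta>\<^sub>g]) (st_sch Ominus [\<Gamma>\<^sub>g, X\<^sub>g] \<turnstile>\<^sub>0 \<Delta>\<^sub>g),
     both_ways Display (Y\<^sub>g \<turnstile>\<^sub>+ st_sch Under_r [X\<^sub>g, Z\<^sub>g]) (st_sch Otimes [X\<^sub>g, Y\<^sub>g] \<turnstile>\<^sub>+ Z\<^sub>g),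
     both_ways Display (st_sch Otimes [X\<^sub>g, Y\<^sub>g] \<turnstile>\<^sub>+ Z\<^sub>g) (X\<^sub>g \<turnstile>\<^sub>+ st_sch Over_l [Z\<^sub>g, Y\<^sub>g]),
     both_ways Display (st_sch Oslash_l [\<Sigma>\<^sub>g, \<Delta>\<^sub>g] \<turnstile>\<^sub>- \<Gamma>\<^sub>g) (\<Sigma>\<^sub>g \<turnstile>\<^sub>- st_sch Oplus [\<Gamma>\<^sub>g, \<Delta>\<^sub>g]),
     both_ways Display (\<Sigma>\<^sub>g \<turnstile>\<^sub>- st_sch Oplus [\<Gamma>\<^sub>g, \<Delta>\<^sub>g]) (st_sch Ominus_r [\<Gamma>\<^sub>g, \<Sigma>\<^sub>g] \<turnstile>\<^sub>- \<Delta>\<^sub>g),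
     both_ways Display (st_sch Ominus [\<Gamma>\<^sub>g, X\<^sub>g] \<turnstile>\<^sub>+ Y\<^sub>g) (X\<^sub>g \<turnstile>\<^sub>+ st_sch Oplus_r [\<Gamma>\<^sub>g, Y\<^sub>g]),
     both_ways Display (X\<^sub>g \<turnstile>\<^sub>+ st_sch Oplus_r [\<Gamma>\<^sub>g, Y\<^sub>g]) (st_sch Oslash_r [X\<^sub>g, Y\<^sub>g] \<turnstile>\<^sub>- \<Gamma>\<^sub>g),
     both_ways Display (st_sch Oslash [X\<^sub>g, \<Delta>\<^sub>g] \<turnstile>\<^sub>+ Y\<^sub>g) (X\<^sub>g \<turnstile>\<^sub>+ st_sch Oplus_l [Y\<^sub>g, \<Delta>\<^sub>g]),
     both_ways Display (X\<^sub>g \<turnstile>\<^sub>+ st_sch Oplus_l [Y\<^sub>g, \<Delta>\<^sub>g]) (st_sch Ominus_l [Y\<^sub>g, X\<^sub>g] \<turnstile>\<^sub>- \<Delta>\<^sub>g),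
     both_ways Display (\<Gamma>\<^sub>g \<turnstile>\<^sub>- st_sch Under [X\<^sub>g, \<Delta>\<^sub>g]) (st_sch Otimes_r [X\<^sub>g, \<Gamma>\<^sub>g] \<turnstile>\<^sub>- \<Delta>\<^sub>g),
     both_ways Display (st_sch Otimes_r [X\<^sub>g, \<Gamma>\<^sub>g] \<turnstile>\<^sub>- \<Delta>\<^sub>g) (X\<^sub>g \<turnstile>\<^sub>+ st_sch Over_r [\<Delta>\<^sub>g, \<Gamma>\<^sub>g]),
     both_ways Display (Y\<^sub>g \<turnstile>\<^sub>+ st_sch Under_l [\<Gamma>\<^sub>g, \<Delta>\<^sub>g]) (st_sch Otimes_l [\<Gamma>\<^sub>g, Y\<^sub>g] \<turnstile>\<^sub>- \<Delta>\<^sub>g),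
     both_ways Display (st_sch Otimes_l [\<Gamma>\<^sub>g, Y\<^sub>g] \<turnstile>\<^sub>- \<Delta>\<^sub>g) (\<Gamma>\<^sub>g \<turnstile>\<^sub>- st_sch Over [\<Delta>\<^sub>g, Y\<^sub>g]),
     both_ways Display (st_sch Up [X\<^sub>p] \<turnstile>\<^sub>- \<Delta>\<^sub>s) (X\<^sub>p \<turnstile>\<^sub>+ st_sch DDown [\<Delta>\<^sub>s]),
     both_ways Display (st_sch Up [X\<^sub>p] \<turnstile>\<^sub>- \<Delta>\<^sub>p) (X\<^sub>p \<turnstile>\<^sub>+ st_sch Down [\<Delta>\<^sub>p]),
     both_ways Display (X\<^sub>s \<turnstile>\<^sub>+ st_sch Down [\<Delta>\<^sub>p]) (st_sch UUp [X\<^sub>s] \<turnstile>\<^sub>- \<Delta>\<^sub>p)]"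

definition structural_rules :: "rule list" where
  "structural_rules =
     both_ways Structural (X\<^sub>g \<turnstile>\<^sub>0 \<Delta>\<^sub>p) (X\<^sub>g \<turnstile>\<^sub>+ st_sch Down [\<Delta>\<^sub>p]) @
     both_ways Structural (X\<^sub>p \<turnstile>\<^sub>0 \<Delta>\<^sub>g) (st_sch Up [X\<^sub>p] \<turnstile>\<^sub>- \<Delta>\<^sub>g)"

definition fDLG_rules :: "rule set" where
  "fDLG_rules = axioms \<union>
     set (cut_rules @ translation_rules @ tonicity_rules @ display_rules @ structural_rules)"


section \<open>Proofs\<close>

text \<open>Each node of a proof-tree carries a sequent and the rule by which it is introduced;
  the children are the proofs of the premises.\<close>

type_synonym proof_tree = "(symbol sequent \<times> rule) tree"

inductive fDLG_proof :: "proof_tree \<Rightarrow> bool" where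
  "Rule k ps c \<in> fDLG_rules \<Longrightarrow> well_sorted \<sigma> \<Longrightarrow>
   map (\<lambda>\<pi>. fst (root_of \<pi>)) \<pi>s = map (inst_sequent \<sigma>) ps \<Longrightarrow>
   (\<forall>\<pi> \<in> set \<pi>s. fDLG_proof \<pi>) \<Longrightarrow>
   fDLG_proof (Node (inst_sequent \<sigma> c, Rule k ps c) \<pi>s)"

definition cut_free :: "proof_tree \<Rightarrow> bool" where
  "cut_free \<pi> \<longleftrightarrow> (\<forall>(S, R) \<in> set_tree \<pi>. class_of R \<noteq> Cut)"

definition lr_variant_free :: "proof_tree \<Rightarrow> bool" where
  "lr_variant_free \<pi> \<longleftrightarrow> (\<forall>(S, R) \<in> set_tree \<pi>. \<forall>c \<in> lr_variants. St c \<notin> set_sequent S)"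


section \<open>Signed generation trees\<close>

datatype sign = SPlus | SMinus

fun opposite :: "sign \<Rightarrow> sign" where
  "opposite SPlus = SMinus"
| "opposite SMinus = SPlus"

datatype order_entry = One | Dual

fun child_sign :: "order_entry \<Rightarrow> sign \<Rightarrow> sign" where
  "child_sign One s = s"
| "child_sign Dual s = opposite s"

fun order_type :: "connective \<Rightarrow> order_entry list" where
  "order_type Otimes = [One, One]"
| "order_type Otimes_l = [One, One]"
| "order_type Otimes_r = [One, One]"
| "order_type Oplus = [One, One]"
| "order_type Oplus_l = [One, One]"
| "order_type Oplus_r = [One, One]"
| "order_type Ominus = [Dual, One]"
| "order_type Ominus_l = [Dual, One]"
| "order_type Ominus_r = [Dual, One]"
| "order_type Under = [Dual, One]"
| "order_type Under_l = [Dual, One]"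
| "order_type Under_r = [Dual, One]"
| "order_type Oslash = [One, Dual]"
| "order_type Oslash_l = [One, Dual]"
| "order_type Oslash_r = [One, Dual]"
| "order_type Over = [One, Dual]"
| "order_type Over_l = [One, Dual]"
| "order_type Over_r = [One, Dual]"
| "order_type Down = [One]"
| "order_type DDown = [One]"
| "order_type Up = [One]"
| "order_type UUp = [One]"

fun symbol_order_type :: "symbol \<Rightarrow> order_entry list" where
  "symbol_order_type (PAtom k) = []"
| "symbol_order_type (NAtom k) = []"
| "symbol_order_type (Op c) = order_type c"
| "symbol_order_type (St c) = order_type c"

function signed_tree :: "sign \<Rightarrow> expr \<Rightarrow> (sign \<times> symbol) tree" where
  "signed_tree s (Node a ts) =
     Node (s, a) (map (\<lambda>(e, t). signed_tree (child_sign e s) t) (zip (symbol_order_type a) ts))"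
  by pat_completeness auto
termination
  by (relation "measure (\<lambda>(s, t). size t)")
     (auto dest!: set_zip_rightD simp: less_Suc_eq_le intro: size_list_estimation')

fun signed_side :: "symbol sequent \<Rightarrow> side \<Rightarrow> (sign \<times> symbol) tree" where
  "signed_side (Sequent e l r) Ante = signed_tree SPlus l"
| "signed_side (Sequent e l r) Succ = signed_tree SMinus r"

definition F_connectives :: "connective set" where
  "F_connectives =
     {Otimes, Otimes_l, Otimes_r, Oslash, Oslash_l, Oslash_r, Ominus, Ominus_l, Ominus_r,
      Up, UUp}"

definition G_connectives :: "connective set" where
  "G_connectives =
     {Oplus, Oplus_l, Oplus_r, Under, Under_l, Under_r, Over, Over_l, Over_r, Down, DDown}"

text \<open>Positive atoms count as F-symbols and negative atoms as G-symbols.\<close>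

fun F_symbol :: "symbol \<Rightarrow> bool" where
  "F_symbol (PAtom k) = True"
| "F_symbol (NAtom k) = False"
| "F_symbol (Op c) = (c \<in> F_connectives)"
| "F_symbol (St c) = (c \<in> F_connectives)"

fun G_symbol :: "symbol \<Rightarrow> bool" where
  "G_symbol (PAtom k) = False"
| "G_symbol (NAtom k) = True"
| "G_symbol (Op c) = (c \<in> G_connectives)"
| "G_symbol (St c) = (c \<in> G_connectives)"

fun skeleton :: "sign \<times> symbol \<Rightarrow> bool" where
  "skeleton (SPlus, a) = F_symbol a"
| "skeleton (SMinus, a) = G_symbol a"

definition PIA_positions :: "(sign \<times> symbol) tree \<Rightarrow> nat list set" where
  "PIA_positions T = {p. \<exists>l. label_at T p = Some l \<and> \<not> skeleton l}"

text \<open>A PIA subtree is given by its set of positions.\<close>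

definition PIA_subtree :: "(sign \<times> symbol) tree \<Rightarrow> nat list set \<Rightarrow> bool" where
  "PIA_subtree T C \<longleftrightarrow>
     C \<noteq> {} \<and> C \<subseteq> PIA_positions T \<and> connected_in_tree C \<and>
     (\<forall>C'. C \<subseteq> C' \<and> C' \<subseteq> PIA_positions T \<and> connected_in_tree C' \<longrightarrow> C' = C)"


section \<open>Tracing occurrences through a proof\<close>

text \<open>An occurrence in a sequent is a side together with a position in that side. An
  occurrence in the conclusion of a rule application that lies in the instance of a
  metavariable corresponds to the occurrence at the same place in the instance of this
  metavariable in the i-th premise.\<close>

fun rule_trace :: "rule \<Rightarrow> side \<times> nat list \<Rightarrow> nat \<Rightarrow> side \<times> nat list \<Rightarrow> bool" where
  "rule_trace (Rule k ps c) (d, p) i (d', p') \<longleftrightarrow>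
     i < length ps \<and>
     (\<exists>v a a' r.
        label_at (side_of c d) a = Some (Meta v) \<and> p = a @ r \<and>
        label_at (side_of (ps ! i) d') a' = Some (Meta v) \<and> p' = a' @ r)"

definition trace_step :: "proof_tree \<Rightarrow> ((nat list \<times> side \<times> nat list) \<times> (nat list \<times> side \<times> nat list)) set" where
  "trace_step \<pi> =
     {((u, o1), (u @ [i], o2)) | u o1 i o2.
        \<exists>S R. label_at \<pi> u = Some (S, R) \<and> rule_trace R o1 i o2}"

text \<open>A rule application introduces the logical connectives that are displayed in the
  conclusion of the rule.\<close>

fun principal :: "rule \<Rightarrow> side \<times> nat list \<Rightarrow> bool" where
  "principal (Rule k ps c) (d, p) \<longleftrightarrow> (\<exists>f. label_at (side_of c d) p = Some (Con (Op f)))"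

definition introduced_at :: "proof_tree \<Rightarrow> nat list \<times> side \<times> nat list \<Rightarrow> nat list \<Rightarrow> bool" where
  "introduced_at \<pi> x w \<longleftrightarrow>
     (\<exists>S R q. (x, (w, q)) \<in> (trace_step \<pi>)\<^sup>* \<and> label_at \<pi> w = Some (S, R) \<and> principal R q)"


section \<open>Proof-sections and strong focalization\<close>

definition inner_nodes :: "nat list set \<Rightarrow> nat list set" where
  "inner_nodes D = {w \<in> D. \<exists>i. w @ [i] \<in> D}"

definition proof_section :: "proof_tree \<Rightarrow> nat list set \<Rightarrow> bool" where
  "proof_section \<pi> D \<longleftrightarrow>
     D \<noteq> {} \<and> D \<subseteq> positions \<pi> \<and> connected_in_tree D \<and>
     (\<forall>w \<in> inner_nodes D. \<forall>i. w @ [i] \<in> positions \<pi> \<longrightarrow> w @ [i] \<in> D)"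

text \<open>The rules applied in a proof-section are those introducing its non-leaf nodes.\<close>

definition only_tonicity :: "proof_tree \<Rightarrow> nat list set \<Rightarrow> bool" where
  "only_tonicity \<pi> D \<longleftrightarrow>
     (\<forall>w \<in> inner_nodes D. \<forall>S R. label_at \<pi> w = Some (S, R) \<longrightarrow> class_of R = Tonicity)"

text \<open>Here \<open>T\<close> is the signed generation tree of the formula at position \<open>q\<close> of side \<open>d\<close> of the
  sequent at node \<open>u\<close>, and \<open>C\<close> a set of positions of \<open>T\<close>.\<close>

definition constructed_by ::
  "proof_tree \<Rightarrow> nat list \<Rightarrow> side \<Rightarrow> nat list \<Rightarrow> (sign \<times> symbol) tree \<Rightarrow> nat list set \<Rightarrow> nat list set \<Rightarrow> bool"
where
  "constructed_by \<pi> u d q T C D \<longleftrightarrow>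
     (\<forall>p \<in> C. \<forall>s c. label_at T p = Some (s, Op c) \<longrightarrow>
        (\<exists>w \<in> inner_nodes D. introduced_at \<pi> (u, d, q @ p) w))"

definition strongly_focalized :: "proof_tree \<Rightarrow> bool" where
  "strongly_focalized \<pi> \<longleftrightarrow>
     cut_free \<pi> \<and>
     (\<forall>u S R d q A T C.
        label_at \<pi> u = Some (S, R) \<longrightarrow>
        subtree (side_of S d) q = Some A \<longrightarrow>
        (\<exists>s. formula A s) \<longrightarrow>
        subtree (signed_side S d) q = Some T \<longrightarrow>
        PIA_subtree T C \<longrightarrow>
        (\<exists>D. proof_section \<pi> D \<and> only_tonicity \<pi> D \<and> constructed_by \<pi> u d q T C D))"

end

theory Submission
  imports Defs
begin

text \<open>
  Every rule other than cut sends each metavariable of its conclusion to a premise, with the same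
  sign, so every connective of a formula can be traced upwards to the rule that introduces it.
  Translation rules introduce skeleton connectives only, hence the root of a PIA subtree is
  introduced by a tonicity rule. The premises of a tonicity rule display the immediate subformulas
  of the principal formula on the right of a positive or on the left of a negative sequent. In such
  a focused place, the only rules that conclude a PIA connective without an left or right variant in a
  premise are again tonicity rules. So the PIA subtree is built inside the maximal section of
  tonicity rules above the introduction of its root.
\<close>

section \<open>Positions in trees\<close>

lemma subtree_append:
  "subtree t (p @ q) = (case subtree t p of None \<Rightarrow> None | Some t' \<Rightarrow> subtree t' q)"
  by (induction t p rule: subtree.induct) auto

lemma label_at_append:
  "subtree t p = Some t' \<Longrightarrow> label_at t (p @ q) = label_at t' q"
  by (simp add: label_at_def subtree_append)

lemma label_at_eq_Some: "label_at t p = Some l \<longleftrightarrow> (\<exists>ts. subtree t p = Some (Node l ts))"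
  by (metis (no_types, lifting) label_at_def map_option_eq_Some tree.collapse tree.sel(1))

lemma label_at_in_set_tree: "label_at t p = Some l \<Longrightarrow> l \<in> set_tree t"
proof (induction t p rule: subtree.induct)
  case (1 t)
  then show ?case by (cases t) (simp add: label_at_def)
next
  case (2 a ts i p)
  then have "i < length ts" "l \<in> set_tree (ts ! i)"
    by (auto simp: label_at_def split: if_splits)
  then show ?case by auto
qed

lemma set_tree_subtree: "subtree t p = Some t' \<Longrightarrow> set_tree t' \<subseteq> set_tree t"
  by (induction t p rule: subtree.induct) (auto split: if_splits)

text \<open>The root is an element of least length. Along a path in \<open>C\<close> starting there,
  a downward edge extends the suffix \<open>r\<close> and an upward edge shortens it; minimal length
  forbids leaving \<open>p\<close> upwards. The second conjunct keeps every node between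
  \<open>p\<close> and \<open>x\<close> in \<open>C\<close>, which permits induction along
  \<open>r\<close>.\<close>

lemma connected_in_tree_rooted:
  assumes "connected_in_tree C" "C \<noteq> {}"
  obtains p where "p \<in> C"
    "\<And>x. x \<in> C \<Longrightarrow> \<exists>r. x = p @ r \<and> (\<forall>r1 r2. r = r1 @ r2 \<longrightarrow> p @ r1 \<in> C)"
proof -
  obtain p where p: "p \<in> C" and min: "\<And>x. x \<in> C \<Longrightarrow> length p \<le> length x"
    using assms(2) ex_has_least_nat[of "\<lambda>x. x \<in> C" _ length] by blast
  have "\<exists>r. x = p @ r \<and> (\<forall>r1 r2. r = r1 @ r2 \<longrightarrow> p @ r1 \<in> C)" if "x \<in> C" for x
  proof -
    have "(p, x) \<in> {(x, y). x \<in> C \<and> y \<in> C \<and> (\<exists>i. y = x @ [i] \<or> x = y @ [i])}\<^sup>*"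
      using assms(1) p that by (simp add: connected_in_tree_def)
    then show ?thesis
    proof induction
      case base
      then show ?case using p by simp
    next
      case (step y z)
      then obtain r i where r: "y = p @ r" "\<And>r1 r2. r = r1 @ r2 \<Longrightarrow> p @ r1 \<in> C"
        and z: "z \<in> C" "z = y @ [i] \<or> y = z @ [i]" by auto
      from z(2) show ?case
      proof
        assume "z = y @ [i]"
        moreover have "p @ r1 \<in> C" if "r @ [i] = r1 @ r2" for r1 r2
          using that r z(1) \<open>z = y @ [i]\<close> by (cases r2 rule: rev_cases) auto
        ultimately show ?thesis using r(1) by (intro exI[of _ "r @ [i]"]) simp
      next
        assume y: "y = z @ [i]"
        have "r \<noteq> []"
          using min[OF z(1)] y r(1) by auto
        then obtain r' where "r = r' @ [i]" "z = p @ r'"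
          using y r(1) by (cases r rule: rev_cases) auto
        then show ?thesis using r(2) by auto
      qed
    qed
  qed
  with p that show thesis by blast
qed


section \<open>Signed labels of schemas\<close>

fun side_sign :: "side \<Rightarrow> sign" where
  "side_sign Ante = SPlus"
| "side_sign Succ = SMinus"

lemma signed_side_eq: "signed_side S d = signed_tree (side_sign d) (side_of S d)"
  by (cases S; cases d) auto

lemma side_of_inst_sequent: "side_of (inst_sequent \<sigma> S) d = inst \<sigma> (side_of S d)"
  by (cases S; cases d) auto

lemma subtree_signed_tree:
  "subtree (signed_tree s t) p = Some T \<Longrightarrow> \<exists>s' t'. subtree t p = Some t' \<and> T = signed_tree s' t'"
proof (induction t p arbitrary: s rule: subtree.induct)
  case (2 a ts i p)
  then show ?case by (auto split: if_splits)
qed auto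

lemma label_at_signed_tree:
  "label_at (signed_tree s t) p = Some (s', a) \<Longrightarrow> a \<in> set_tree t"
proof -
  assume "label_at (signed_tree s t) p = Some (s', a)"
  then obtain s1 t' where "subtree t p = Some t'" "root_of (signed_tree s1 t') = (s', a)"
    by (auto simp: label_at_def dest!: subtree_signed_tree)
  then have "label_at t p = Some a"
    by (cases t') (simp add: label_at_def)
  then show ?thesis by (rule label_at_in_set_tree)
qed

lemma set_sequent_side_of: "set_tree (side_of S d) \<subseteq> set_sequent S"
  by (cases S; cases d) auto

lemma formula_no_structural: "formula t s \<Longrightarrow> St c \<notin> set_tree t"
proof (induction rule: formula.induct)
  case (formula_Op k ts)
  then show ?case by (auto simp: list_all2_conv_all_nth in_set_conv_nth)
qed auto

text \<open>Signs are read off the schema before instantiation, so facts about all instances of a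
  rule become executable checks on its schema. Nothing lies below a metavariable because
  \<open>inst\<close> discards its children.\<close>

fun schema_at :: "sign \<Rightarrow> schema \<Rightarrow> nat list \<Rightarrow> (sign \<times> schematic) option" where
  "schema_at s (Node x ts) [] = Some (s, x)"
| "schema_at s (Node (Meta v) ts) (i # p) = None"
| "schema_at s (Node (Con a) ts) (i # p) =
     (if i < length ts \<and> i < length (symbol_order_type a)
      then schema_at (child_sign (symbol_order_type a ! i) s) (ts ! i) p else None)"

definition sequent_at :: "schematic sequent \<Rightarrow> side \<Rightarrow> nat list \<Rightarrow> (sign \<times> schematic) option" where
  "sequent_at S d p = schema_at (side_sign d) (side_of S d) p"

lemma schema_at_label: "schema_at s t p = Some (s', x) \<Longrightarrow> label_at t p = Some x"
  by (induction s t p rule: schema_at.induct) (auto simp: label_at_def split: if_splits)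

lemma sequent_at_label: "sequent_at S d p = Some (s, x) \<Longrightarrow> label_at (side_of S d) p = Some x"
  by (simp add: sequent_at_def schema_at_label)

text \<open>The sign at a metavariable depends on the schema alone, so two occurrences of
  \<open>v\<close> with equal sign carry the same signed tree in every instance.\<close>

lemma schema_at_Meta:
  "schema_at s t p = Some (s', Meta v) \<Longrightarrow>
   subtree (signed_tree s (inst \<sigma> t)) (p @ r) = subtree (signed_tree s' (\<sigma> v)) r"
  by (induction s t p rule: schema_at.induct) (auto split: if_splits)

lemma schema_at_Con:
  "schema_at s t p = Some (s', Con a) \<Longrightarrow> label_at (signed_tree s (inst \<sigma> t)) p = Some (s', a)"
  by (induction s t p rule: schema_at.induct) (auto simp: label_at_def split: if_splits)

text \<open>The dichotomy behind all tracing: a node is either displayed by the schema, hence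
  possibly introduced by the rule, or belongs to the instance of a metavariable, hence possibly
  inherited from a premise.\<close>

lemma signed_tree_inst_cases:
  assumes "label_at (signed_tree s (inst \<sigma> t)) p = Some (s', a)"
  obtains (Con) "schema_at s t p = Some (s', Con a)"
  | (Meta) q r s1 v where "p = q @ r" "schema_at s t q = Some (s1, Meta v)"
proof -
  have "schema_at s t p = Some (s', Con a) \<or>
      (\<exists>q r s1 v. p = q @ r \<and> schema_at s t q = Some (s1, Meta v))"
    using assms
  proof (induction s t p rule: schema_at.induct)
    case (1 s x ts)
    then show ?case by (cases x) (auto simp: label_at_def)
  next
    case (2 s v ts i p)
    have "schema_at s (Node (Meta v) ts) [] = Some (s, Meta v)" by simp
    then show ?case by (metis append_Nil)
  next
    case (3 s b ts i p)
    from 3(2) have i: "i < length ts" "i < length (symbol_order_type b)"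
      by (auto simp: label_at_def split: if_splits)
    with 3(2) have "label_at (signed_tree (child_sign (symbol_order_type b ! i) s) (inst \<sigma> (ts ! i))) p
        = Some (s', a)"
      by (auto simp: label_at_def)
    with 3(1) i consider
      "schema_at (child_sign (symbol_order_type b ! i) s) (ts ! i) p = Some (s', Con a)"
      | q r s1 v where "p = q @ r"
        "schema_at (child_sign (symbol_order_type b ! i) s) (ts ! i) q = Some (s1, Meta v)"
      by blast
    then show ?case
    proof cases
      case 1
      then show ?thesis using i by simp
    next
      case (2 q r s1 v)
      then have "i # p = (i # q) @ r" "schema_at s (Node (Con b) ts) (i # q) = Some (s1, Meta v)"
        using i by simp_all
      then show ?thesis by blast
    qed
  qed
  then show thesis using that by blast
qed


section \<open>The shape of the rules\<close>

text \<open>These are the sides on which the premises of tonicity rules hold the arguments of the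
  principal connective. The principal formula itself need not be on such a side: tonicity puts
  \<open>Down\<close> on the left of a positive and \<open>Up\<close> on the right of a negative
  sequent.\<close>

fun focused :: "'a sequent \<Rightarrow> side \<Rightarrow> bool" where
  "focused (Sequent Positive l r) Succ = True"
| "focused (Sequent Negative l r) Ante = True"
| "focused _ _ = False"

lemma focused_inst_sequent [simp]: "focused (inst_sequent \<sigma> S) d = focused S d"
  by (cases "(S, d)" rule: focused.cases) auto

definition flat :: "schema \<Rightarrow> bool" where
  "flat t \<longleftrightarrow> length (children t) \<le> 2 \<and> list_all (\<lambda>u. children u = []) (children t)"

lemma schema_at_flat:
  assumes "flat t" "schema_at s t p = Some y"
  shows "p \<in> {[], [0], [1]}"
proof (cases "(s, t, p)" rule: schema_at.cases)
  case (3 s a ts i q)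
  with assms have i: "i < length ts" and q: "schema_at (child_sign (symbol_order_type a ! i) s) (ts ! i) q = Some y"
    by (auto split: if_splits)
  from assms(1) 3 i have "i < 2" "children (ts ! i) = []"
    by (auto simp: flat_def list_all_length)
  then obtain x where "ts ! i = Node x []" by (cases "ts ! i") simp
  with q have "q = []" by (cases q; cases x) auto
  with 3 \<open>i < 2\<close> show ?thesis by auto
qed (use assms in auto)

lemmas rule_lists_def = cut_rules_def translation_rules_def
  tonicity_rules_def display_rules_def structural_rules_def

lemma fDLG_rules_flat:
  "Rule k ps c \<in> fDLG_rules \<Longrightarrow> flat (side_of c d)"
  by (cases d) (auto simp: fDLG_rules_def axioms_def rule_lists_def flat_def)

lemma sequent_at_conclusion_cases:
  assumes "Rule k ps c \<in> fDLG_rules" "sequent_at c d p = Some y"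
  shows "p = [] \<or> p = [0] \<or> p = [1]"
  using assms schema_at_flat[OF fDLG_rules_flat] by (fastforce simp: sequent_at_def)

text \<open>A finite list, so that properties of its rules can be settled by evaluation. Axioms form
  infinite families and are treated separately.\<close>

definition noncut_rules :: "rule list" where
  "noncut_rules = translation_rules @ tonicity_rules @ display_rules @ structural_rules"

text \<open>Reduces a property of all conclusions to a finite check: schemas have depth at most one, and
  axioms display only atoms.\<close>

lemma noncut_rules_check:
  assumes "\<forall>R \<in> set noncut_rules. case R of Rule k ps c \<Rightarrow>
      \<forall>d \<in> {Ante, Succ}. \<forall>p \<in> {[], [0], [1]}. Q k ps c d p"
    and "Rule k ps c \<in> fDLG_rules" "k \<noteq> Cut" "sequent_at c d p = Some (s, x)"
  shows "k = Axiom \<and> (\<exists>a. x = Con (PAtom a) \<or> x = Con (NAtom a)) \<or> Q k ps c d p"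
proof (cases "Rule k ps c \<in> axioms")
  case True
  with assms(4) sequent_at_conclusion_cases[OF assms(2,4)] show ?thesis
    by (cases d) (auto simp: axioms_def sequent_at_def)
next
  case False
  have "\<forall>R \<in> set cut_rules. class_of R = Cut" by (simp add: cut_rules_def)
  with False assms(2,3) have "Rule k ps c \<in> set noncut_rules"
    by (auto simp: fDLG_rules_def noncut_rules_def)
  with assms(1) have "\<forall>d \<in> {Ante, Succ}. \<forall>p \<in> {[], [0], [1]}. Q k ps c d p" by fastforce
  moreover have "d \<in> {Ante, Succ}" by (cases d) auto
  moreover have "p \<in> {[], [0], [1]}" using sequent_at_conclusion_cases[OF assms(2,4)] by simp
  ultimately show ?thesis by blast
qed

text \<open>The point is that the sign survives. Display postulates may move a structure across the
  turnstile, but the order-types of the connectives involved compensate for the change of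
  side.\<close>

lemma metavariable_in_premise:
  assumes "Rule k ps c \<in> fDLG_rules" "k \<noteq> Cut" "sequent_at c d p = Some (s, Meta v)"
  shows "\<exists>S \<in> set ps. \<exists>d' p'. sequent_at S d' p' = Some (s, Meta v)"
proof -
  have "\<forall>R \<in> set noncut_rules. case R of Rule k ps c \<Rightarrow>
    \<forall>d \<in> {Ante, Succ}. \<forall>p \<in> {[], [0], [1]}. case sequent_at c d p of
      Some (s, Meta v) \<Rightarrow> \<exists>S \<in> set ps. \<exists>d' \<in> {Ante, Succ}. \<exists>p' \<in> {[], [0], [1]}.
        sequent_at S d' p' = Some (s, Meta v)
    | _ \<Rightarrow> True"
    by code_simp
  from noncut_rules_check[OF this assms] assms(3) show ?thesis by auto
qed

text \<open>Translation rules display F-connectives on the left and G-connectives on the right,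
  which are skeleton nodes. Tonicity rules display them on the opposite sides, at the root. Display
  and structural rules display no operational connective.\<close>

lemma PIA_connective_in_conclusion:
  assumes "Rule k ps c \<in> fDLG_rules" "k \<noteq> Cut"
    and "sequent_at c d p = Some (s, Con (Op f))" "\<not> skeleton (s, Op f)"
  shows "k = Tonicity \<and> p = []"
proof -
  have "\<forall>R \<in> set noncut_rules. case R of Rule k ps c \<Rightarrow>
    \<forall>d \<in> {Ante, Succ}. \<forall>p \<in> {[], [0], [1]}. case sequent_at c d p of
      Some (s, Con (Op f)) \<Rightarrow> skeleton (s, Op f) \<or> k = Tonicity \<and> p = []
    | _ \<Rightarrow> True"
    by code_simp
  from noncut_rules_check[OF this assms(1-3)] assms(3,4) show ?thesis by auto
qed

lemma tonicity_has_premise: "Rule Tonicity ps c \<in> fDLG_rules \<Longrightarrow> ps \<noteq> []"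
  by (auto simp: fDLG_rules_def axioms_def rule_lists_def)

text \<open>Each argument of the principal connective is a metavariable forming one whole side of a
  premise: a positive argument on the right of a positive sequent, with sign minus, and a negative
  one on the left of a negative sequent, with sign plus.\<close>

lemma tonicity_premises_focused:
  assumes "Rule Tonicity ps c \<in> fDLG_rules" "sequent_at c d [] = Some (s, Con (Op f))"
    "sequent_at c d [j] = Some (s', x)"
  shows "\<exists>v. x = Meta v \<and> (\<exists>S \<in> set ps. \<exists>d'. focused S d' \<and> sequent_at S d' [] = Some (s', Meta v))"
proof -
  have "\<forall>R \<in> set noncut_rules. case R of Rule k ps c \<Rightarrow>
    \<forall>d \<in> {Ante, Succ}. \<forall>p \<in> {[], [0], [1]}. k = Tonicity \<and> p \<noteq> [] \<longrightarrow>
      (case sequent_at c d [] of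
        Some (s, Con (Op f)) \<Rightarrow>
          (case sequent_at c d p of
            Some (s', Meta v) \<Rightarrow> \<exists>S \<in> set ps. \<exists>d' \<in> {Ante, Succ}.
              focused S d' \<and> sequent_at S d' [] = Some (s', Meta v)
          | Some (s', Con a) \<Rightarrow> False
          | None \<Rightarrow> True)
      | _ \<Rightarrow> True)"
    by code_simp
  from noncut_rules_check[OF this assms(1) _ assms(3)] assms(2,3) show ?thesis
    by (cases x) auto
qed

text \<open>Apart from cut, only display postulates conclude with a bare metavariable on a focused
  side. Each of them extracts it from a structure in the premise whose main connective is a variant,
  such as \<open>Z\<close> from \<open>Under_r\<close> or \<open>Over_l\<close>.\<close>

lemma focused_metavariable_lr_variant:
  assumes "Rule k ps c \<in> fDLG_rules" "k \<noteq> Cut" "focused c d" "sequent_at c d [] = Some (s, Meta v)"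
  shows "\<exists>S \<in> set ps. \<exists>d' x. x \<in> lr_variants \<and> sequent_at S d' [] = Some (side_sign d', Con (St x))"
proof -
  have "\<forall>R \<in> set noncut_rules. case R of Rule k ps c \<Rightarrow>
    \<forall>d \<in> {Ante, Succ}. \<forall>p \<in> {[], [0], [1]}. p = [] \<and> focused c d \<longrightarrow>
      (case sequent_at c d p of
        Some (s, Meta v) \<Rightarrow> \<exists>S \<in> set ps. \<exists>d' \<in> {Ante, Succ}. \<exists>x \<in> lr_variants.
          sequent_at S d' [] = Some (side_sign d', Con (St x))
      | _ \<Rightarrow> True)"
    by code_simp
  from noncut_rules_check[OF this assms(1,2,4)] assms(3,4)
  have "\<exists>S \<in> set ps. \<exists>d' \<in> {Ante, Succ}. \<exists>x \<in> lr_variants.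
      sequent_at S d' [] = Some (side_sign d', Con (St x))" by simp
  then show ?thesis by blast
qed


section \<open>Tracing connectives through a proof\<close>

lemma fDLG_proof_subtree:
  "subtree \<pi> u = Some \<pi>' \<Longrightarrow> fDLG_proof \<pi> \<Longrightarrow> fDLG_proof \<pi>'"
proof (induction \<pi> u rule: subtree.induct)
  case (2 a ts i p)
  from 2(3) have "\<forall>t \<in> set ts. fDLG_proof t" by cases auto
  with 2(1,2) show ?case by (auto split: if_splits)
qed simp

lemma fDLG_proof_node:
  assumes "fDLG_proof \<pi>" "label_at \<pi> u = Some (S, R)"
  obtains k ps c \<sigma> where "R = Rule k ps c" "Rule k ps c \<in> fDLG_rules" "S = inst_sequent \<sigma> c"
    "\<And>i. i < length ps \<Longrightarrow> \<exists>R'. label_at \<pi> (u @ [i]) = Some (inst_sequent \<sigma> (ps ! i), R')"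
proof -
  from assms(2) obtain \<pi>s where u: "subtree \<pi> u = Some (Node (S, R) \<pi>s)"
    by (auto simp: label_at_eq_Some)
  with assms(1) have "fDLG_proof (Node (S, R) \<pi>s)" by (rule fDLG_proof_subtree[rotated])
  then obtain k ps c \<sigma> where R: "R = Rule k ps c" "Rule k ps c \<in> fDLG_rules" "S = inst_sequent \<sigma> c"
    and ps: "map (\<lambda>\<pi>. fst (root_of \<pi>)) \<pi>s = map (inst_sequent \<sigma>) ps"
    by cases auto
  have "\<exists>R'. label_at \<pi> (u @ [i]) = Some (inst_sequent \<sigma> (ps ! i), R')" if "i < length ps" for i
  proof -
    have len: "length \<pi>s = length ps" using ps map_eq_imp_length_eq by blast
    with that ps have "fst (root_of (\<pi>s ! i)) = inst_sequent \<sigma> (ps ! i)"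
      by (metis nth_map)
    then obtain R' where "root_of (\<pi>s ! i) = (inst_sequent \<sigma> (ps ! i), R')"
      by (metis prod.collapse)
    then show ?thesis
      using that len by (simp add: label_at_def subtree_append u)
  qed
  with R that show thesis by blast
qed

lemma rule_trace_append:
  "rule_trace R (d, p) i (d', p') \<Longrightarrow> rule_trace R (d, p @ r) i (d', p' @ r)"
  by (cases R) (simp, metis append.assoc)

lemma trace_step_append:
  "((u, d, p), (w, d', p')) \<in> trace_step \<pi> \<Longrightarrow> ((u, d, p @ r), (w, d', p' @ r)) \<in> trace_step \<pi>"
  by (force simp: trace_step_def intro: rule_trace_append)

text \<open>A trace of the root of a PIA subtree thereby carries along all positions below that
  root.\<close>

lemma trace_steps_append:
  "((u, d, p), (w, d', p')) \<in> (trace_step \<pi>)\<^sup>* \<Longrightarrow>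
   ((u, d, p @ r), (w, d', p' @ r)) \<in> (trace_step \<pi>)\<^sup>*"
proof (induction "(w, d', p')" arbitrary: w d' p' rule: rtrancl_induct)
  case (step y)
  then show ?case
    by (cases y) (metis rtrancl.rtrancl_into_rtrancl trace_step_append)
qed simp

text \<open>Equal signs at both occurrences make the traced signed subtree literally the same, so
  PIA nodes stay PIA nodes along a trace.\<close>

lemma metavariable_trace:
  assumes "label_at \<pi> u = Some (inst_sequent \<sigma> c, Rule k ps c)" "i < length ps"
    and "sequent_at c d a = Some (s, Meta v)" "sequent_at (ps ! i) d' a' = Some (s, Meta v)"
  shows "((u, d, a @ r), (u @ [i], d', a' @ r)) \<in> trace_step \<pi>"
    and "subtree (signed_side (inst_sequent \<sigma> (ps ! i)) d') (a' @ r) =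
      subtree (signed_side (inst_sequent \<sigma> c) d) (a @ r)"
proof -
  have "rule_trace (Rule k ps c) (d, a @ r) i (d', a' @ r)"
    using assms(2) sequent_at_label[OF assms(3)] sequent_at_label[OF assms(4)] by auto
  then show "((u, d, a @ r), (u @ [i], d', a' @ r)) \<in> trace_step \<pi>"
    using assms(1) unfolding trace_step_def by blast
  show "subtree (signed_side (inst_sequent \<sigma> (ps ! i)) d') (a' @ r) =
      subtree (signed_side (inst_sequent \<sigma> c) d) (a @ r)"
    using assms(3,4) by (simp add: signed_side_eq side_of_inst_sequent sequent_at_def schema_at_Meta)
qed

text \<open>The principal position is the root, so \<open>T\<close> is a whole side with no
  structure around it.\<close>

definition tonicity_intro :: "proof_tree \<Rightarrow> nat list \<Rightarrow> side \<Rightarrow> (sign \<times> symbol) tree \<Rightarrow> bool" where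
  "tonicity_intro \<pi> w d T \<longleftrightarrow>
     (\<exists>S R. label_at \<pi> w = Some (S, R) \<and> class_of R = Tonicity \<and> principal R (d, []) \<and>
        signed_side S d = T)"

lemma PIA_connective_introduced:
  assumes "fDLG_proof \<pi>" "cut_free \<pi>" "label_at \<pi> u = Some (S, R)"
    and "subtree (signed_side S d) p = Some T" "root_of T = (s, Op f)" "\<not> skeleton (s, Op f)"
  shows "\<exists>w d'. ((u, d, p), (w, d', [])) \<in> (trace_step \<pi>)\<^sup>* \<and> tonicity_intro \<pi> w d' T"
  using assms(3,4)
\<comment> \<open>As long as the connective is inherited through a metavariable, the trace moves to
  a premise, whose subproof is smaller.\<close>
proof (induction "size (the (subtree \<pi> u))" arbitrary: u S R d p rule: less_induct)
  case less
  obtain k ps c \<sigma> where R: "R = Rule k ps c" "Rule k ps c \<in> fDLG_rules" "S = inst_sequent \<sigma> c"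
    and prem: "\<And>i. i < length ps \<Longrightarrow> \<exists>R'. label_at \<pi> (u @ [i]) = Some (inst_sequent \<sigma> (ps ! i), R')"
    using fDLG_proof_node[OF assms(1) less.prems(1)] by metis
  have "k \<noteq> Cut"
    using assms(2) label_at_in_set_tree[OF less.prems(1)] R(1) by (auto simp: cut_free_def)
  have "label_at (signed_tree (side_sign d) (inst \<sigma> (side_of c d))) p = Some (s, Op f)"
    using less.prems(2) assms(5) R(3) by (simp add: label_at_def signed_side_eq side_of_inst_sequent)
  then show ?case
  proof (cases rule: signed_tree_inst_cases)
    case Con
    then have at: "sequent_at c d p = Some (s, Con (Op f))" by (simp add: sequent_at_def)
    with R(2) \<open>k \<noteq> Cut\<close> assms(6) have "k = Tonicity" "p = []"
      using PIA_connective_in_conclusion by blast+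
    then have "tonicity_intro \<pi> u d T"
      using less.prems R(1) sequent_at_label[OF at] by (simp add: tonicity_intro_def)
    then show ?thesis using \<open>p = []\<close> by blast
  next
    case (Meta q r s1 v)
    then have at: "sequent_at c d q = Some (s1, Meta v)" by (simp add: sequent_at_def)
    then obtain i d' p' where i: "i < length ps" and at': "sequent_at (ps ! i) d' p' = Some (s1, Meta v)"
      using metavariable_in_premise[OF R(2) \<open>k \<noteq> Cut\<close>] by (metis in_set_conv_nth)
    have step: "((u, d, p), (u @ [i], d', p' @ r)) \<in> trace_step \<pi>"
      and sub: "subtree (signed_side (inst_sequent \<sigma> (ps ! i)) d') (p' @ r) = Some T"
      using metavariable_trace[OF _ i at at'] less.prems R Meta(1) by auto
    obtain R' where R': "label_at \<pi> (u @ [i]) = Some (inst_sequent \<sigma> (ps ! i), R')"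
      using prem i by blast
    obtain \<pi>s where "subtree \<pi> u = Some (Node (S, R) \<pi>s)"
      using less.prems(1) by (auto simp: label_at_eq_Some)
    moreover from this R' have "i < length \<pi>s"
      by (auto simp: label_at_def subtree_append split: if_splits)
    ultimately have "size (the (subtree \<pi> (u @ [i]))) < size (the (subtree \<pi> u))"
      by (simp add: subtree_append less_Suc_eq_le size_list_estimation'[OF nth_mem order_refl])
    from less.hyps[OF this R' sub] step show ?thesis
      by (meson converse_rtrancl_into_rtrancl)
  qed
qed

lemma focused_PIA_tonicity_intro:
  assumes "fDLG_proof \<pi>" "cut_free \<pi>" "lr_variant_free \<pi>"
    and "label_at \<pi> u = Some (S, R)" "focused S d"
    and "root_of (signed_side S d) = (s, Op f)" "\<not> skeleton (s, Op f)"
  shows "tonicity_intro \<pi> u d (signed_side S d)"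
proof -
  obtain k ps c \<sigma> where R: "R = Rule k ps c" "Rule k ps c \<in> fDLG_rules" "S = inst_sequent \<sigma> c"
    and prem: "\<And>i. i < length ps \<Longrightarrow> \<exists>R'. label_at \<pi> (u @ [i]) = Some (inst_sequent \<sigma> (ps ! i), R')"
    using fDLG_proof_node[OF assms(1,4)] by metis
  have "k \<noteq> Cut"
    using assms(2) label_at_in_set_tree[OF assms(4)] R(1) by (auto simp: cut_free_def)
  have "label_at (signed_tree (side_sign d) (inst \<sigma> (side_of c d))) [] = Some (s, Op f)"
    using assms(6) R(3) by (simp add: label_at_def signed_side_eq side_of_inst_sequent)
  then show ?thesis
  proof (cases rule: signed_tree_inst_cases)
    case Con
    then have at: "sequent_at c d [] = Some (s, Con (Op f))" by (simp add: sequent_at_def)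
    with R(2) \<open>k \<noteq> Cut\<close> assms(7) have "k = Tonicity" using PIA_connective_in_conclusion by blast
    then show ?thesis
      using assms(4) R(1) sequent_at_label[OF at] by (simp add: tonicity_intro_def)
  next
    case (Meta q r s1 v)
    \<comment> \<open>The root position splits only as \<open>[] @ []\<close>, so the whole focused
      side is a metavariable. Some premise then contains a variant, contradicting
      \<open>lr_variant_free\<close>.\<close>
    then have "sequent_at c d [] = Some (s1, Meta v)" by (simp add: sequent_at_def)
    moreover have "focused c d" using assms(5) R(3) by simp
    ultimately obtain i d' x where i: "i < length ps" and x: "x \<in> lr_variants"
      and at: "sequent_at (ps ! i) d' [] = Some (side_sign d', Con (St x))"
      using focused_metavariable_lr_variant[OF R(2) \<open>k \<noteq> Cut\<close>] by (metis in_set_conv_nth)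
    let ?S = "inst_sequent \<sigma> (ps ! i)"
    have "label_at (signed_side ?S d') [] = Some (side_sign d', St x)"
      using at by (simp add: sequent_at_def signed_side_eq side_of_inst_sequent schema_at_Con)
    then have "St x \<in> set_tree (side_of ?S d')"
      unfolding signed_side_eq by (rule label_at_signed_tree)
    then have "St x \<in> set_sequent ?S" using set_sequent_side_of by (rule subsetD[rotated])
    moreover obtain R' where "label_at \<pi> (u @ [i]) = Some (?S, R')" using prem[OF i] by blast
    then have "(?S, R') \<in> set_tree \<pi>" by (rule label_at_in_set_tree)
    ultimately show ?thesis using assms(3) x by (auto simp: lr_variant_free_def)
  qed
qed

text \<open>Focus propagates: the argument at \<open>j\<close> is a whole focused side of a premise,
  and a PIA connective there can only come from another tonicity rule.\<close>

lemma tonicity_intro_child: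
  assumes "fDLG_proof \<pi>" "cut_free \<pi>" "lr_variant_free \<pi>"
    and "tonicity_intro \<pi> v d T" "subtree T [j] = Some T'"
    and "root_of T' = (s, Op f)" "\<not> skeleton (s, Op f)"
  shows "\<exists>i d'. ((v, d, [j]), (v @ [i], d', [])) \<in> trace_step \<pi> \<and> tonicity_intro \<pi> (v @ [i]) d' T'"
proof -
  from assms(4) obtain S R where v: "label_at \<pi> v = Some (S, R)" "class_of R = Tonicity"
    "principal R (d, [])" "signed_side S d = T"
    by (auto simp: tonicity_intro_def)
  obtain ps c \<sigma> where R: "R = Rule Tonicity ps c" "Rule Tonicity ps c \<in> fDLG_rules" "S = inst_sequent \<sigma> c"
    and prem: "\<And>i. i < length ps \<Longrightarrow> \<exists>R'. label_at \<pi> (v @ [i]) = Some (inst_sequent \<sigma> (ps ! i), R')"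
    using fDLG_proof_node[OF assms(1) v(1)] v(2) by (metis class_of.simps)
  obtain g ts where c: "side_of c d = Node (Con (Op g)) ts"
    using v(3) R(1) by (auto simp: label_at_eq_Some)
  have T: "T = signed_tree (side_sign d) (inst \<sigma> (side_of c d))"
    using v(4) R(3) by (simp add: signed_side_eq side_of_inst_sequent)
  with assms(5) c have "j < length ts" "j < length (order_type g)"
    by (auto split: if_splits)
  then obtain s' x where at: "sequent_at c d [j] = Some (s', x)"
    using c by (cases "ts ! j") (simp add: sequent_at_def)
  have "sequent_at c d [] = Some (side_sign d, Con (Op g))"
    using c by (simp add: sequent_at_def)
  from tonicity_premises_focused[OF R(2) this at] obtain y i d'
    where x: "x = Meta y" and i: "i < length ps" and foc: "focused (ps ! i) d'"
      and at': "sequent_at (ps ! i) d' [] = Some (s', Meta y)"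
    by (metis in_set_conv_nth)
  let ?S = "inst_sequent \<sigma> (ps ! i)"
  have "((v, d, [j]), (v @ [i], d', [])) \<in> trace_step \<pi>"
    and "subtree (signed_side ?S d') [] = subtree (signed_side S d) [j]"
    using metavariable_trace[OF _ i at[unfolded x] at', of \<pi> v \<sigma> Tonicity "[]"] v(1) R by simp_all
  moreover from this(2) have sub: "signed_side ?S d' = T'"
    using assms(5) v(4) by simp
  moreover obtain R' where "label_at \<pi> (v @ [i]) = Some (?S, R')" using prem[OF i] by blast
  ultimately show ?thesis
    using focused_PIA_tonicity_intro[OF assms(1-3), of "v @ [i]" ?S R' d' s f] foc assms(6,7)
    by auto
qed


section \<open>Maximal tonicity sections\<close>

text \<open>Only the nodes strictly below \<open>w @ r\<close>, starting from \<open>w\<close>, have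
  to be tonicity inferences. The last node is unconstrained, so the section contains all premises of
  its tonicity inferences.\<close>

definition tonicity_section :: "proof_tree \<Rightarrow> nat list \<Rightarrow> nat list set" where
  "tonicity_section \<pi> w = {w @ r | r. w @ r \<in> positions \<pi> \<and>
     (\<forall>r1 i r2. r = r1 @ i # r2 \<longrightarrow>
        (\<exists>S R. label_at \<pi> (w @ r1) = Some (S, R) \<and> class_of R = Tonicity))}"

lemma positions_append: "p @ q \<in> positions t \<Longrightarrow> p \<in> positions t"
  by (auto simp: positions_def subtree_append split: option.splits)

lemma label_at_positions: "label_at t p = Some l \<Longrightarrow> p \<in> positions t"
  by (auto simp: positions_def label_at_def)

lemma tonicity_section_parent:
  assumes "w @ r @ [i] \<in> tonicity_section \<pi> w"
  shows "w @ r \<in> tonicity_section \<pi> w"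
proof -
  have "\<exists>S R. label_at \<pi> (w @ r1) = Some (S, R) \<and> class_of R = Tonicity" if "r = r1 @ j # r2" for r1 j r2
  proof -
    have "r @ [i] = r1 @ j # (r2 @ [i])" using that by simp
    then show ?thesis using assms unfolding tonicity_section_def by blast
  qed
  moreover have "w @ r \<in> positions \<pi>"
    using assms positions_append[of "w @ r" "[i]" \<pi>] by (auto simp: tonicity_section_def)
  ultimately show ?thesis unfolding tonicity_section_def by blast
qed

text \<open>The condition on the rule at \<open>v\<close> does not depend on \<open>i\<close>. This
  yields both closure under premises and the fact that inner nodes are tonicity inferences.\<close>

lemma tonicity_section_child_iff:
  assumes "v \<in> tonicity_section \<pi> w"
  shows "v @ [i] \<in> tonicity_section \<pi> w \<longleftrightarrow> v @ [i] \<in> positions \<pi> \<and>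
     (\<exists>S R. label_at \<pi> v = Some (S, R) \<and> class_of R = Tonicity)"
proof -
  obtain r where r: "v = w @ r" "\<And>r1 j r2. r = r1 @ j # r2 \<Longrightarrow>
      \<exists>S R. label_at \<pi> (w @ r1) = Some (S, R) \<and> class_of R = Tonicity"
    using assms unfolding tonicity_section_def by blast
  have "(\<forall>r1 j r2. r @ [i] = r1 @ j # r2 \<longrightarrow>
        (\<exists>S R. label_at \<pi> (w @ r1) = Some (S, R) \<and> class_of R = Tonicity)) \<longleftrightarrow>
      (\<exists>S R. label_at \<pi> (w @ r) = Some (S, R) \<and> class_of R = Tonicity)" (is "?l \<longleftrightarrow> ?r")
  proof
    assume ?r
    show ?l
    proof (intro allI impI)
      fix r1 j r2
      assume "r @ [i] = r1 @ j # r2"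
      then show "\<exists>S R. label_at \<pi> (w @ r1) = Some (S, R) \<and> class_of R = Tonicity"
        using \<open>?r\<close> r(2) by (cases r2 rule: rev_cases) auto
    qed
  qed auto
  then show ?thesis by (simp add: tonicity_section_def r(1))
qed

lemma tonicity_section_connected:
  assumes "w \<in> positions \<pi>"
  shows "connected_in_tree (tonicity_section \<pi> w)"
proof -
  let ?D = "tonicity_section \<pi> w"
  let ?E = "{(x, y). x \<in> ?D \<and> y \<in> ?D \<and> (\<exists>i. y = x @ [i] \<or> x = y @ [i])}"
  have down: "w @ r \<in> ?D \<Longrightarrow> (w, w @ r) \<in> ?E\<^sup>*" for r
  proof (induction r rule: rev_induct)
    case (snoc i r)
    then have "w @ r \<in> ?D" by (simp add: tonicity_section_parent)
    with snoc have "(w, w @ r) \<in> ?E\<^sup>*" "(w @ r, w @ r @ [i]) \<in> ?E" by auto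
    then show ?case by (rule rtrancl.rtrancl_into_rtrancl)
  qed simp
  \<comment> \<open>Edges run both ways, so any two nodes are joined by a path through
    \<open>w\<close>.\<close>
  have sym: "sym (?E\<^sup>*)" by (rule sym_rtrancl) (auto simp: sym_def)
  have "(w, a) \<in> ?E\<^sup>*" if "a \<in> ?D" for a
    using that down by (auto simp: tonicity_section_def)
  then show ?thesis
    unfolding connected_in_tree_def using sym by (meson symD rtrancl_trans)
qed

lemma proof_section_tonicity_section:
  assumes "w \<in> positions \<pi>"
  shows "proof_section \<pi> (tonicity_section \<pi> w)" "only_tonicity \<pi> (tonicity_section \<pi> w)"
proof -
  have "w \<in> tonicity_section \<pi> w" using assms by (simp add: tonicity_section_def)
  moreover have "tonicity_section \<pi> w \<subseteq> positions \<pi>" by (auto simp: tonicity_section_def)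
  ultimately show "proof_section \<pi> (tonicity_section \<pi> w)"
    using tonicity_section_connected[OF assms]
    by (auto simp: proof_section_def inner_nodes_def tonicity_section_child_iff)
  show "only_tonicity \<pi> (tonicity_section \<pi> w)"
    by (auto simp: only_tonicity_def inner_nodes_def tonicity_section_child_iff)
qed

text \<open>The rules applied in a section are those at its non-leaf nodes. Since a tonicity rule
  has a premise, \<open>v\<close> has a child in the section.\<close>

lemma tonicity_intro_inner_node:
  assumes "fDLG_proof \<pi>" "tonicity_intro \<pi> v d T" "v \<in> tonicity_section \<pi> w"
  shows "v \<in> inner_nodes (tonicity_section \<pi> w)"
proof -
  from assms(2) obtain S R where v: "label_at \<pi> v = Some (S, R)" "class_of R = Tonicity"
    by (auto simp: tonicity_intro_def)
  obtain k ps c \<sigma> where R: "R = Rule k ps c" "Rule k ps c \<in> fDLG_rules"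
    and prem: "\<And>i. i < length ps \<Longrightarrow> \<exists>R'. label_at \<pi> (v @ [i]) = Some (inst_sequent \<sigma> (ps ! i), R')"
    using fDLG_proof_node[OF assms(1) v(1)] by metis
  have "0 < length ps" using R v(2) tonicity_has_premise by auto
  then obtain R' where "label_at \<pi> (v @ [0]) = Some (inst_sequent \<sigma> (ps ! 0), R')"
    using prem by blast
  then have "v @ [0] \<in> positions \<pi>" by (rule label_at_positions)
  then show ?thesis
    using assms(3) v tonicity_section_child_iff[OF assms(3), of 0] by (auto simp: inner_nodes_def)
qed

section \<open>PIA subtrees inside a tonicity section\<close>

text \<open>Atoms have an empty order-type and thus no children in the signed tree, and structural
  connectives are absent from \<open>A\<close>; a node with an operational descendant must itself be
  operational.\<close>

lemma ancestor_Op: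
  assumes "\<And>c. St c \<notin> set_tree A" "label_at (signed_tree s A) (r @ r') = Some (s', Op f)"
    and "label_at (signed_tree s A) r = Some (s1, a)"
  shows "\<exists>g. a = Op g"
proof (cases r')
  case Nil
  then show ?thesis using assms by simp
next
  case (Cons i r'')
  from assms(3) obtain T where T: "subtree (signed_tree s A) r = Some T" "root_of T = (s1, a)"
    by (auto simp: label_at_def)
  from subtree_signed_tree[OF T(1)] obtain s2 b ts where Tb: "T = signed_tree s2 (Node b ts)"
    by (metis tree.exhaust)
  with T(2) have "b = a" by simp
  moreover have "symbol_order_type b \<noteq> []"
    using assms(2) label_at_append[OF T(1), of r'] Tb Cons by (auto simp: label_at_def)
  moreover have "a \<noteq> St g" for g
    using assms(1) label_at_signed_tree[OF assms(3)] by blast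
  ultimately show ?thesis by (cases a) auto
qed

text \<open>Induction along the path \<open>r\<close> from the root of the PIA subtree: each further
  connective is introduced one premise higher, by a tonicity rule, so the section is never
  left.\<close>

lemma PIA_connective_in_section:
  assumes \<pi>: "fDLG_proof \<pi>" "cut_free \<pi>" "lr_variant_free \<pi>"
    and w: "tonicity_intro \<pi> w d (signed_tree s0 A)" and A: "\<And>c. St c \<notin> set_tree A"
  shows "(\<And>r1 r2. r = r1 @ r2 \<Longrightarrow> r1 \<in> PIA_positions (signed_tree s0 A)) \<Longrightarrow>
    subtree (signed_tree s0 A) r = Some T' \<Longrightarrow> root_of T' = (s, Op f) \<Longrightarrow>
    \<exists>v \<in> tonicity_section \<pi> w. \<exists>d'. ((w, d, r), (v, d', [])) \<in> (trace_step \<pi>)\<^sup>* \<and>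
      tonicity_intro \<pi> v d' T'"
proof (induction r arbitrary: T' s f rule: rev_induct)
  case Nil
  have "w \<in> positions \<pi>"
    using w by (auto simp: tonicity_intro_def intro: label_at_positions)
  then have "w \<in> tonicity_section \<pi> w" by (simp add: tonicity_section_def)
  then show ?case using Nil(2) w by auto
next
  case (snoc j r)
  let ?T = "signed_tree s0 A"
  have PIA: "r1 \<in> PIA_positions ?T" if "r = r1 @ r2" for r1 r2
    using snoc.prems(1)[of r1 "r2 @ [j]"] that by simp
  from snoc.prems(2) obtain T where T: "subtree ?T r = Some T" "subtree T [j] = Some T'"
    by (auto simp: subtree_append split: option.splits)
  obtain s1 a where Ta: "root_of T = (s1, a)" by force
  have "\<exists>g. a = Op g"
    using ancestor_Op[OF A, of s0 r "[j]" s f s1 a] snoc.prems(2,3) T(1) Ta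
    by (simp add: label_at_def)
  then obtain g where "root_of T = (s1, Op g)" using Ta by blast
  from snoc.IH[OF _ T(1) this] PIA obtain v d1 where v: "v \<in> tonicity_section \<pi> w"
    and tr: "((w, d, r), (v, d1, [])) \<in> (trace_step \<pi>)\<^sup>*" and intro: "tonicity_intro \<pi> v d1 T"
    by blast
  have "r @ [j] \<in> PIA_positions ?T" using snoc.prems(1)[of "r @ [j]" "[]"] by simp
  then have "\<not> skeleton (s, Op f)"
    using snoc.prems(2,3) by (auto simp: PIA_positions_def label_at_def)
  from tonicity_intro_child[OF \<pi> intro T(2) snoc.prems(3) this] obtain i d'
    where step: "((v, d1, [j]), (v @ [i], d', [])) \<in> trace_step \<pi>"
      and intro': "tonicity_intro \<pi> (v @ [i]) d' T'" by blast
  have "((w, d, r @ [j]), (v @ [i], d', [])) \<in> (trace_step \<pi>)\<^sup>*"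
    using trace_steps_append[OF tr, of "[j]"] step by (simp add: rtrancl.rtrancl_into_rtrancl)
  moreover have "v @ [i] \<in> tonicity_section \<pi> w"
    using tonicity_section_child_iff[OF v] intro intro'
    by (auto simp: tonicity_intro_def intro: label_at_positions)
  ultimately show ?case using intro' by blast
qed

theorem theorem22:
  fixes \<pi> :: proof_tree
  assumes "fDLG_proof \<pi>"
    and "cut_free \<pi>"
    and "lr_variant_free \<pi>"
  shows "strongly_focalized \<pi>"
  unfolding strongly_focalized_def
proof (intro conjI allI impI)
  fix u S R d q A T C
  assume u: "label_at \<pi> u = Some (S, R)" and A: "subtree (side_of S d) q = Some A"
    and "\<exists>s. formula A s" and T: "subtree (signed_side S d) q = Some T" and C: "PIA_subtree T C"
  then have so: "St c \<notin> set_tree A" for c using formula_no_structural by blast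
  obtain s0 where T': "T = signed_tree s0 A"
    using subtree_signed_tree[OF T[unfolded signed_side_eq]] A by auto
  have PIA: "C \<subseteq> PIA_positions T" using C by (simp add: PIA_subtree_def)
  obtain p0 where p0: "p0 \<in> C"
    and below: "\<And>x. x \<in> C \<Longrightarrow> \<exists>r. x = p0 @ r \<and> (\<forall>r1 r2. r = r1 @ r2 \<longrightarrow> p0 @ r1 \<in> C)"
    using connected_in_tree_rooted[of C] C by (metis PIA_subtree_def)
  obtain s1 a where a: "label_at T p0 = Some (s1, a)" "\<not> skeleton (s1, a)"
    using p0 PIA by (auto simp: PIA_positions_def)
  show "\<exists>D. proof_section \<pi> D \<and> only_tonicity \<pi> D \<and> constructed_by \<pi> u d q T C D"
  proof (cases "\<exists>p \<in> C. \<exists>s c. label_at T p = Some (s, Op c)")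
    case False
    \<comment> \<open>A PIA subtree without connectives, such as a single atom, asks for no
      introduction; the one-node section applies no rule.\<close>
    then have "constructed_by \<pi> u d q T C {u}" by (auto simp: constructed_by_def)
    moreover have "proof_section \<pi> {u}" "only_tonicity \<pi> {u}"
      using label_at_positions[OF u]
      by (auto simp: proof_section_def only_tonicity_def inner_nodes_def connected_in_tree_def)
    ultimately show ?thesis by blast
  next
    case True
    \<comment> \<open>The root \<open>p0\<close> of \<open>C\<close> lies at or above some
      operational node of \<open>C\<close>, hence is operational.\<close>
    then obtain g where g: "a = Op g"
      using below ancestor_Op[OF so] a(1) unfolding T' by metis
    obtain T0 where T0: "subtree T p0 = Some T0" "root_of T0 = (s1, Op g)"
      using a(1) g by (auto simp: label_at_def)
    from subtree_signed_tree[OF T0(1)[unfolded T']] obtain s2 A0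
      where A0: "subtree A p0 = Some A0" "T0 = signed_tree s2 A0" by blast
    have "subtree (signed_side S d) (q @ p0) = Some T0"
      using T T0(1) by (simp add: subtree_append)
    then obtain w d' where tr: "((u, d, q @ p0), (w, d', [])) \<in> (trace_step \<pi>)\<^sup>*"
      and w: "tonicity_intro \<pi> w d' T0"
      using PIA_connective_introduced[OF assms(1,2) u] T0(2) a(2) g by blast
    have "constructed_by \<pi> u d q T C (tonicity_section \<pi> w)"
      unfolding constructed_by_def
    proof (intro ballI allI impI)
      fix p s f
      assume "p \<in> C" and f: "label_at T p = Some (s, Op f)"
      then obtain r where r: "p = p0 @ r" "\<And>r1 r2. r = r1 @ r2 \<Longrightarrow> p0 @ r1 \<in> C"
        using below by blast
      have pos: "r1 \<in> PIA_positions T0" if "r = r1 @ r2" for r1 r2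
        using r(2)[OF that] PIA label_at_append[OF T0(1)] by (auto simp: PIA_positions_def)
      obtain T1 where T1: "subtree T0 r = Some T1" "root_of T1 = (s, Op f)"
        using f T0(1) r(1) by (auto simp: label_at_def subtree_append)
      have "St c \<notin> set_tree A0" for c using so set_tree_subtree[OF A0(1)] by blast
      then obtain v d1 where v: "v \<in> tonicity_section \<pi> w"
        and tr': "((w, d', r), (v, d1, [])) \<in> (trace_step \<pi>)\<^sup>*" and intro: "tonicity_intro \<pi> v d1 T1"
        using PIA_connective_in_section[OF assms, of w d' s2 A0 r T1 s f] w pos T1
        unfolding A0(2) by blast
      \<comment> \<open>First the trace of the root to \<open>w\<close>, extended by the suffix
        \<open>r\<close>, then the trace within the section up to \<open>v\<close>.\<close>
      have "((u, d, q @ p), (v, d1, [])) \<in> (trace_step \<pi>)\<^sup>*"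
        using trace_steps_append[OF tr, of r] tr' r(1) by simp
      with intro have "introduced_at \<pi> (u, d, q @ p) v"
        by (auto simp: introduced_at_def tonicity_intro_def)
      then show "\<exists>v \<in> inner_nodes (tonicity_section \<pi> w). introduced_at \<pi> (u, d, q @ p) v"
        using tonicity_intro_inner_node[OF assms(1) intro v] by blast
    qed
    moreover have "w \<in> positions \<pi>"
      using w by (auto simp: tonicity_intro_def intro: label_at_positions)
    ultimately show ?thesis using proof_section_tonicity_section by blast
  qed
qed (rule assms(2))

end
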